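(* Let $p,q,r$ be distinct propositional variables. None of the following four formulas belongs to Tarski's relevance logic $\mathcal{L}_4$: (contraposition) $(p\to{\sim}q)\to(q\to{\sim}p)$; (permutation) $(p\to(q\to r))\to(q\to(p\to r))$; (suffixing) $(p\to q)\to((q\to r)\to(p\to r))$; (modus ponens axiom) $p\to((p\to q)\to q)$.
   Context: Formulas are built from a countable set of propositional variables using the binary connectives $\lor,\land,\to$ and the unary connective $\sim$. An assertion $A_{ij}$ is a formula $A$ together with an ordered pair of indices $i,j\in\{0,1,2,3\}$. A sequent $\Gamma\Rightarrow\Delta$ is an ordered pair of sets of assertions; commas denote union, and either side may be empty. A 4-proof is a finite sequence of sequents each of which is an Axiom or follows from one or two earlier sequents by a rule below ($\Gamma,\Gamma',\Delta,\Delta'$ are arbitrary sets of assertions, $i,j,k\in\{0,1,2,3\}$): - Axiom: $\Gamma\Rightarrow\Delta$ whenever $\Gamma\cap\Delta\neq\emptyset$. - Cut: from $\Gamma\Rightarrow\Delta,A_{ij}$ and $A_{ij},\Gamma'\Rightarrow\Delta'$ infer $\Gamma,\Gamma'\Rightarrow\Delta,\Delta'$. - Weakening: from $\Gamma\Rightarrow\Delta$ infer $\Gamma,\Gamma'\Rightarrow\Delta,\Delta'$. - $\lor|$: from $\Gamma,A_{ij}\Rightarrow\Delta$ and $\Gamma',B_{ij}\Rightarrow\Delta'$ infer $\Gamma,\Gamma',(A\lor B)_{ij}\Rightarrow\Delta,\Delta'$. - $|\lor$: from $\Gamma\Rightarrow\Delta,A_{ij},B_{ij}$ infer $\Gamma\Rightarrow\Delta,(A\lor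 B)_{ij}$. - $\land|$: from $\Gamma,A_{ij},B_{ij}\Rightarrow\Delta$ infer $\Gamma,(A\land B)_{ij}\Rightarrow\Delta$. - $|\land$: from $\Gamma\Rightarrow\Delta,A_{ij}$ and $\Gamma'\Rightarrow\Delta',B_{ij}$ infer $\Gamma,\Gamma'\Rightarrow\Delta,\Delta',(A\land B)_{ij}$. - ${\sim}|$: from $\Gamma\Rightarrow\Delta,A_{ij}$ infer $\Gamma,({\sim}A)_{ji}\Rightarrow\Delta$. - $|{\sim}$: from $\Gamma,A_{ij}\Rightarrow\Delta$ infer $\Gamma\Rightarrow\Delta,({\sim}A)_{ji}$. - ${\to}|$: from $\Gamma\Rightarrow\Delta,A_{ki}$ and $\Gamma',B_{kj}\Rightarrow\Delta'$ infer $\Gamma,\Gamma',(A\to B)_{ij}\Rightarrow\Delta,\Delta'$. - $|{\to}$: from $\Gamma,A_{ki}\Rightarrow\Delta,B_{kj}$ infer $\Gamma\Rightarrow\Delta,(A\to B)_{ij}$, provided $k\neq i,j$ and $k$ does not occur as a subscript in any assertion of $\Gamma\cup\Delta$. Tarski's relevance logic $\mathcal{L}_4$ is the set of formulas $A$ such that the sequent $\Rightarrow A_{00}$ appears in some 4-proof. *)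

theory Defs
  imports Main "HOL-Library.Numeral_Type"
begin

datatype formula =
    Var nat
  | Or formula formula  (infixr "\<^bold>\<or>" 65)
  | And formula formula  (infixr "\<^bold>\<and>" 68)
  | Imp formula formula  (infixr "\<^bold>\<rightarrow>" 60)
  | Neg formula  ("\<^bold>\<sim> _" [72] 72)

text \<open>The index set \<open>{0,1,2,3}\<close> is the four-element type \<open>4\<close>; its arithmetic plays no role.\<close>

datatype assertion = Assertion formula (fst_index: 4) (snd_index: 4)  ("_\<langle>_,_\<rangle>" [90, 0, 0] 90)

text \<open>The two sides of a sequent are arbitrary sets, possibly infinite.\<close>

type_synonym sequent = "assertion set \<times> assertion set"

definition indices :: "assertion set \<Rightarrow> 4 set" where
  "indices \<Gamma> = fst_index ` \<Gamma> \<union> snd_index ` \<Gamma>"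

text \<open>\<open>follows S s\<close>: the sequent \<open>s\<close> is an axiom or the conclusion of one rule whose
  premises all lie in \<open>S\<close>. The commas of the calculus are unions, so a displayed assertion
  may also belong to the set it is inserted into.\<close>

inductive follows :: "sequent set \<Rightarrow> sequent \<Rightarrow> bool" for S where
  Axiom: "\<Gamma> \<inter> \<Delta> \<noteq> {} \<Longrightarrow> follows S (\<Gamma>, \<Delta>)"
| Cut: "(\<Gamma>, insert (A\<langle>i,j\<rangle>) \<Delta>) \<in> S \<Longrightarrow> (insert (A\<langle>i,j\<rangle>) \<Gamma>', \<Delta>') \<in> S
    \<Longrightarrow> follows S (\<Gamma> \<union> \<Gamma>', \<Delta> \<union> \<Delta>')"
| Weakening: "(\<Gamma>, \<Delta>) \<in> S \<Longrightarrow> follows S (\<Gamma> \<union> \<Gamma>', \<Delta> \<union> \<Delta>')"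
| OrL: "(insert (A\<langle>i,j\<rangle>) \<Gamma>, \<Delta>) \<in> S \<Longrightarrow> (insert (B\<langle>i,j\<rangle>) \<Gamma>', \<Delta>') \<in> S
    \<Longrightarrow> follows S (insert ((A \<^bold>\<or> B)\<langle>i,j\<rangle>) (\<Gamma> \<union> \<Gamma>'), \<Delta> \<union> \<Delta>')"
| OrR: "(\<Gamma>, insert (A\<langle>i,j\<rangle>) (insert (B\<langle>i,j\<rangle>) \<Delta>)) \<in> S
    \<Longrightarrow> follows S (\<Gamma>, insert ((A \<^bold>\<or> B)\<langle>i,j\<rangle>) \<Delta>)"
| AndL: "(insert (A\<langle>i,j\<rangle>) (insert (B\<langle>i,j\<rangle>) \<Gamma>), \<Delta>) \<in> S
    \<Longrightarrow> follows S (insert ((A \<^bold>\<and> B)\<langle>i,j\<rangle>) \<Gamma>, \<Delta>)"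
| AndR: "(\<Gamma>, insert (A\<langle>i,j\<rangle>) \<Delta>) \<in> S \<Longrightarrow> (\<Gamma>', insert (B\<langle>i,j\<rangle>) \<Delta>') \<in> S
    \<Longrightarrow> follows S (\<Gamma> \<union> \<Gamma>', insert ((A \<^bold>\<and> B)\<langle>i,j\<rangle>) (\<Delta> \<union> \<Delta>'))"
| NegL: "(\<Gamma>, insert (A\<langle>i,j\<rangle>) \<Delta>) \<in> S \<Longrightarrow> follows S (insert ((\<^bold>\<sim> A)\<langle>j,i\<rangle>) \<Gamma>, \<Delta>)"
| NegR: "(insert (A\<langle>i,j\<rangle>) \<Gamma>, \<Delta>) \<in> S \<Longrightarrow> follows S (\<Gamma>, insert ((\<^bold>\<sim> A)\<langle>j,i\<rangle>) \<Delta>)"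
| ImpL: "(\<Gamma>, insert (A\<langle>k,i\<rangle>) \<Delta>) \<in> S \<Longrightarrow> (insert (B\<langle>k,j\<rangle>) \<Gamma>', \<Delta>') \<in> S
    \<Longrightarrow> follows S (insert ((A \<^bold>\<rightarrow> B)\<langle>i,j\<rangle>) (\<Gamma> \<union> \<Gamma>'), \<Delta> \<union> \<Delta>')"
| ImpR: "(insert (A\<langle>k,i\<rangle>) \<Gamma>, insert (B\<langle>k,j\<rangle>) \<Delta>) \<in> S
    \<Longrightarrow> k \<noteq> i \<Longrightarrow> k \<noteq> j \<Longrightarrow> k \<notin> indices (\<Gamma> \<union> \<Delta>)
    \<Longrightarrow> follows S (\<Gamma>, insert ((A \<^bold>\<rightarrow> B)\<langle>i,j\<rangle>) \<Delta>)"

definition four_proof :: "sequent list \<Rightarrow> bool" where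
  "four_proof P \<longleftrightarrow> (\<forall>n < length P. follows (set (take n P)) (P ! n))"

definition L4 :: "formula set" where
  "L4 = {A. \<exists>P. four_proof P \<and> ({}, {A\<langle>0,0\<rangle>}) \<in> set P}"

end

theory Submission
  imports Defs
begin

text \<open>
  The calculus is the relational reading of formulas in disguise. Interpret each variable by a
  binary relation on a set \<open>U\<close>, disjunction and conjunction by union and intersection, \<open>\<^bold>\<sim>\<close> by
  the complement of the converse, and \<open>A \<^bold>\<rightarrow> B\<close> by the residual of the relations \<open>R\<close> of \<open>A\<close> and
  \<open>S\<close> of \<open>B\<close>, the largest relation \<open>X\<close> with \<open>R O X \<subseteq> S\<close>. Read the indices as names of points of \<open>U\<close>. Then all rules preserve
  truth under every naming; the freshness condition on \<open>\<rightarrow>\<close> on the right says that the fresh name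
  may be moved to any point. Hence a member of the logic denotes a relation containing the whole
  diagonal of \<open>U\<close> (\<open>L4_reflexive\<close>).

  This makes the four formulas easy to refute, since each of them needs some commutativity of
  relational composition: contraposition, for example, says that \<open>P O Q \<subseteq> Q O P\<close> for the relations
  \<open>P\<close> and \<open>Q\<close> of \<open>p\<close> and \<open>q\<close>. On two points, with
  \<open>P = {(False, True)}\<close> and \<open>Q = {(True, True)}\<close>, the composition \<open>P O Q\<close> is \<open>P\<close> while \<open>Q O P\<close> is
  empty. With \<open>{(True, False)}\<close> for the remaining variable \<open>r\<close>, this one model refutes all four.
\<close>

fun holds :: "(nat \<Rightarrow> 'u rel) \<Rightarrow> formula \<Rightarrow> 'u \<Rightarrow> 'u \<Rightarrow> bool" where
  "holds V (Var n) x y \<longleftrightarrow> (x, y) \<in> V n"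
| "holds V (A \<^bold>\<or> B) x y \<longleftrightarrow> holds V A x y \<or> holds V B x y"
| "holds V (A \<^bold>\<and> B) x y \<longleftrightarrow> holds V A x y \<and> holds V B x y"
| "holds V (A \<^bold>\<rightarrow> B) x y \<longleftrightarrow> (\<forall>z. holds V A z x \<longrightarrow> holds V B z y)"
| "holds V (\<^bold>\<sim> A) x y \<longleftrightarrow> \<not> holds V A y x"

fun true_under :: "(nat \<Rightarrow> 'u rel) \<Rightarrow> (4 \<Rightarrow> 'u) \<Rightarrow> assertion \<Rightarrow> bool" where
  "true_under V e (A\<langle>i,j\<rangle>) \<longleftrightarrow> holds V A (e i) (e j)"

definition valid_sequent :: "(nat \<Rightarrow> 'u rel) \<Rightarrow> sequent \<Rightarrow> bool" where
  "valid_sequent V s \<longleftrightarrow>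
     (\<forall>e. (\<forall>a \<in> fst s. true_under V e a) \<longrightarrow> (\<exists>a \<in> snd s. true_under V e a))"

lemma true_under_fresh_update:
  assumes "a \<in> \<Gamma>" "k \<notin> indices \<Gamma>"
  shows "true_under V (e(k := z)) a \<longleftrightarrow> true_under V e a"
proof (cases a)
  case (Assertion A i j)
  with assms have "i \<noteq> k" "j \<noteq> k"
    by (force simp: indices_def)+
  with Assertion show ?thesis by simp
qed

text \<open>Only the right rule for implication needs more than unfolding. A point \<open>z\<close> refuting
  \<open>A \<^bold>\<rightarrow> B\<close> at the points named by \<open>i\<close> and \<open>j\<close> is given the name \<open>k\<close>; freshness keeps
  the truth values of the side assertions, so the renaming refutes the premise.\<close>

lemma follows_sound:
  assumes "follows S s" and "\<forall>t \<in> S. valid_sequent V t"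
  shows "valid_sequent V s"
  using assms
proof (induction rule: follows.induct)
  case (ImpR A k i \<Gamma> B j \<Delta>)
  then have prem: "valid_sequent V (insert (A\<langle>k,i\<rangle>) \<Gamma>, insert (B\<langle>k,j\<rangle>) \<Delta>)"
    by blast
  show ?case
    unfolding valid_sequent_def
  proof (intro allI impI)
    fix e
    assume \<Gamma>: "\<forall>a \<in> fst (\<Gamma>, insert ((A \<^bold>\<rightarrow> B)\<langle>i,j\<rangle>) \<Delta>). true_under V e a"
    show "\<exists>a \<in> snd (\<Gamma>, insert ((A \<^bold>\<rightarrow> B)\<langle>i,j\<rangle>) \<Delta>). true_under V e a"
    proof (rule ccontr)
      assume neg: "\<not> ?thesis"
      then obtain z where z: "holds V A z (e i)" "\<not> holds V B z (e j)"
        by auto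
      let ?e = "e(k := z)"
      have same: "true_under V ?e a \<longleftrightarrow> true_under V e a" if "a \<in> \<Gamma> \<union> \<Delta>" for a
        using that ImpR.hyps(4) by (rule true_under_fresh_update)
      have "\<forall>a \<in> insert (A\<langle>k,i\<rangle>) \<Gamma>. true_under V ?e a"
        using \<Gamma> z(1) same ImpR.hyps(2)[symmetric] by simp
      then have "\<exists>a \<in> insert (B\<langle>k,j\<rangle>) \<Delta>. true_under V ?e a"
        using prem unfolding valid_sequent_def fst_conv snd_conv by blast
      then show False
        using neg z(2) same ImpR.hyps(3)[symmetric] by auto
    qed
  qed
next
  case (Cut \<Gamma> A i j \<Delta> \<Gamma>' \<Delta>')
  from bspec[OF Cut.prems Cut.hyps(1)] bspec[OF Cut.prems Cut.hyps(2)]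
  show ?case by (simp add: valid_sequent_def) blast
next
  case (OrL A i j \<Gamma> \<Delta> B \<Gamma>' \<Delta>')
  from bspec[OF OrL.prems OrL.hyps(1)] bspec[OF OrL.prems OrL.hyps(2)]
  show ?case by (simp add: valid_sequent_def) blast
next
  case (AndR \<Gamma> A i j \<Delta> \<Gamma>' B \<Delta>')
  from bspec[OF AndR.prems AndR.hyps(1)] bspec[OF AndR.prems AndR.hyps(2)]
  show ?case by (simp add: valid_sequent_def) blast
next
  case (ImpL \<Gamma> A k i \<Delta> B j \<Gamma>' \<Delta>')
  from bspec[OF ImpL.prems ImpL.hyps(1)] bspec[OF ImpL.prems ImpL.hyps(2)]
  show ?case by (simp add: valid_sequent_def) blast
qed (fastforce simp: valid_sequent_def)+

lemma four_proof_sound: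
  assumes "four_proof P" "n < length P"
  shows "valid_sequent V (P ! n)"
  using assms(2)
proof (induction n rule: less_induct)
  case (less n)
  have "valid_sequent V t" if t: "t \<in> set (take n P)" for t
  proof -
    from t obtain m where "m < n" "m < length P" "t = P ! m"
      by (metis in_set_conv_nth length_take min_less_iff_conj nth_take)
    with less.IH show ?thesis by simp
  qed
  then have "\<forall>t \<in> set (take n P). valid_sequent V t"
    by blast
  with less.prems assms(1) show ?case
    by (auto simp: four_proof_def intro: follows_sound)
qed

text \<open>The index \<open>0\<close> may name any point, so derivability at the single pair \<open>0, 0\<close> gives the
  whole diagonal.\<close>

lemma L4_reflexive:
  assumes "A \<in> L4"
  shows "holds V A x x"
proof -
  from assms obtain P n where "four_proof P" "n < length P" "P ! n = ({}, {A\<langle>0,0\<rangle>})"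
    by (auto simp: L4_def in_set_conv_nth)
  then have "valid_sequent V ({}, {A\<langle>0,0\<rangle>})"
    using four_proof_sound[of P n V] by simp
  then show ?thesis
    unfolding valid_sequent_def by (auto dest: spec[of _ "\<lambda>_. x"])
qed

theorem mainTheorem3:
  fixes p q r :: nat
  assumes "distinct [p, q, r]"
  shows "((Var p \<^bold>\<rightarrow> \<^bold>\<sim> Var q) \<^bold>\<rightarrow> (Var q \<^bold>\<rightarrow> \<^bold>\<sim> Var p)) \<notin> L4 \<and>
    ((Var p \<^bold>\<rightarrow> (Var q \<^bold>\<rightarrow> Var r)) \<^bold>\<rightarrow> (Var q \<^bold>\<rightarrow> (Var p \<^bold>\<rightarrow> Var r))) \<notin> L4 \<and>
    ((Var p \<^bold>\<rightarrow> Var q) \<^bold>\<rightarrow> ((Var q \<^bold>\<rightarrow> Var r) \<^bold>\<rightarrow> (Var p \<^bold>\<rightarrow> Var r))) \<notin> L4 \<and>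
    (Var p \<^bold>\<rightarrow> ((Var p \<^bold>\<rightarrow> Var q) \<^bold>\<rightarrow> Var q)) \<notin> L4"
proof -
  define V :: "nat \<Rightarrow> bool rel" where
    "V = (\<lambda>_. {})(p := {(False, True)}, q := {(True, True)}, r := {(True, False)})"
  have V: "V p = {(False, True)}" "V q = {(True, True)}" "V r = {(True, False)}"
    using assms by (auto simp: V_def)
  \<comment> \<open>Contraposition fails only at \<open>False\<close>, where the path in \<open>P O Q\<close> starts; the modus ponens
    axiom only at \<open>True\<close>, where the pair of \<open>P\<close> ends.\<close>
  have "\<not> holds V ((Var p \<^bold>\<rightarrow> \<^bold>\<sim> Var q) \<^bold>\<rightarrow> (Var q \<^bold>\<rightarrow> \<^bold>\<sim> Var p)) False False"
    by (auto simp: V)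
  moreover have "\<not> holds V ((Var p \<^bold>\<rightarrow> (Var q \<^bold>\<rightarrow> Var r)) \<^bold>\<rightarrow> (Var q \<^bold>\<rightarrow> (Var p \<^bold>\<rightarrow> Var r))) True True"
    by (auto simp: V)
  moreover have "\<not> holds V ((Var p \<^bold>\<rightarrow> Var q) \<^bold>\<rightarrow> ((Var q \<^bold>\<rightarrow> Var r) \<^bold>\<rightarrow> (Var p \<^bold>\<rightarrow> Var r))) True True"
    by (auto simp: V)
  moreover have "\<not> holds V (Var p \<^bold>\<rightarrow> ((Var p \<^bold>\<rightarrow> Var q) \<^bold>\<rightarrow> Var q)) True True"
    by (auto simp: V)
  ultimately show ?thesis
    by (intro conjI) (erule contrapos_nn, erule L4_reflexive)+
qed

end
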